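(* For all integers $g\ge 0$, there is an injection $$\mathcal F(g,4)\longrightarrow\mathcal F(g+1,4).$$ In particular, $n_{g+1,4}\ge n_{g,4}$ for all $g\ge 0$.
   Context: Notation: $\mathbb N=\{0,1,2,\dots\}$, $\mathbb N_+=\{1,2,\dots\}$, and $[a,b]$ denotes the integer interval $\{z\in\mathbb Z: a\le z\le b\}$. A numerical semigroup is a subset $S\subseteq\mathbb N$ containing $0$, stable under addition and with finite complement in $\mathbb N$. Its genus is $|\mathbb N\setminus S|$ and its multiplicity is $\min(S\setminus\{0\})$. For integers $g\ge 0$, $m\ge 1$, $n_{g,m}$ denotes the (finite) number of numerical semigroups of genus $g$ and multiplicity $m$. A gapset is a finite set $G\subset\mathbb N_+$ such that for all $z\in G$, if $z=x+y$ with $x,y\in\mathbb N_+$, then $x\in G$ or $y\in G$ (equivalently, $\mathbb N\setminus G$ is a numerical semigroup). Its multiplicity is the smallest integer $m\ge 1$ with $m\notin G$; its genus is $|G|$; its conductor is $c=1+\max(G)$ if $G\ne\emptyset$ and $c=0$ otherwise; its depth is $q=\lceil c/m\rceil$. For a gapset $G$ of multiplicity $m$ and depth $q$, put $G_i=G\cap[im+1,(i+1)m-1]$ and $F_i=-im+G_i=\{x-im: x\in G_i\}$ for $0\le i\le q-1$. The gapset filtration associated to $G$ is the finite sequence $(F_0,F_1,\dots,F_{q-1})$; its multiplicity and genus are those of $G$ (so its genus is $\sum_i|F_i|$). $\mathcal F(g,m)$ denotes the set of all gapset filtrations of genus $g$ and multiplicity $m$. *)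

theory Defs
  imports Complex_Main
begin

definition numerical_semigroup :: "nat set \<Rightarrow> bool" where
  "numerical_semigroup S \<longleftrightarrow> 0 \<in> S \<and> (\<forall>x\<in>S. \<forall>y\<in>S. x + y \<in> S) \<and> finite (- S)"

definition semigroup_genus :: "nat set \<Rightarrow> nat" where
  "semigroup_genus S = card (- S)"

definition semigroup_multiplicity :: "nat set \<Rightarrow> nat" where
  "semigroup_multiplicity S = (LEAST n. n \<in> S - {0})"

definition numerical_semigroups :: "nat \<Rightarrow> nat \<Rightarrow> nat set set" where
  "numerical_semigroups g m =
     {S. numerical_semigroup S \<and> semigroup_genus S = g \<and> semigroup_multiplicity S = m}"

definition num_semigroups :: "nat \<Rightarrow> nat \<Rightarrow> nat" where
  "num_semigroups g m = card (numerical_semigroups g m)"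

definition gapset :: "nat set \<Rightarrow> bool" where
  "gapset G \<longleftrightarrow> finite G \<and> 0 \<notin> G \<and>
     (\<forall>z\<in>G. \<forall>x y. 1 \<le> x \<and> 1 \<le> y \<and> z = x + y \<longrightarrow> x \<in> G \<or> y \<in> G)"

definition gapset_multiplicity :: "nat set \<Rightarrow> nat" where
  "gapset_multiplicity G = (LEAST m. 1 \<le> m \<and> m \<notin> G)"

definition gapset_genus :: "nat set \<Rightarrow> nat" where
  "gapset_genus G = card G"

definition gapset_conductor :: "nat set \<Rightarrow> nat" where
  "gapset_conductor G = (if G = {} then 0 else 1 + Max G)"

definition gapset_depth :: "nat set \<Rightarrow> nat" where
  "gapset_depth G = nat \<lceil>real (gapset_conductor G) / real (gapset_multiplicity G)\<rceil>"

definition gapset_layer :: "nat set \<Rightarrow> nat \<Rightarrow> nat set" where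
  "gapset_layer G i =
     (let m = gapset_multiplicity G in G \<inter> {i * m + 1 .. (i + 1) * m - 1})"

text \<open>The truncated subtraction below is harmless: every element of the \<open>i\<close>-th layer
  exceeds \<open>i * m\<close>.\<close>

definition gapset_filtration :: "nat set \<Rightarrow> nat set list" where
  "gapset_filtration G =
     map (\<lambda>i. (\<lambda>x. x - i * gapset_multiplicity G) ` gapset_layer G i) [0..<gapset_depth G]"

definition gapset_filtrations :: "nat \<Rightarrow> nat \<Rightarrow> nat set list set" where
  "gapset_filtrations g m =
     {gapset_filtration G | G. gapset G \<and> gapset_genus G = g \<and> gapset_multiplicity G = m}"

text \<open>Finiteness of the set counted by \<^const>\<open>num_semigroups\<close>, so that its cardinality is
  a genuine count: the largest gap is less than twice the genus.\<close>

lemma gap_less_twice_genus: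
  assumes S: "numerical_semigroup S" and f: "f \<notin> S"
  shows "f < 2 * semigroup_genus S"
proof -
  have fin: "finite (- S)" using S by (simp add: numerical_semigroup_def)
  have "{..f} \<subseteq> (- S) \<union> (\<lambda>x. f - x) ` (- S)"
  proof
    fix x assume "x \<in> {..f}"
    then have x: "x \<le> f" by simp
    then have "x \<notin> S \<or> f - x \<notin> S"
      using S f unfolding numerical_semigroup_def by (metis le_add_diff_inverse)
    moreover have "x = f - (f - x)" using x by simp
    ultimately show "x \<in> (- S) \<union> (\<lambda>x. f - x) ` (- S)" by blast
  qed
  then have "card {..f} \<le> card ((- S) \<union> (\<lambda>x. f - x) ` (- S))"
    using fin by (intro card_mono) auto
  also have "\<dots> \<le> card (- S) + card (- S)"
    using card_Un_le[of "- S" "(\<lambda>x. f - x) ` (- S)"] card_image_le[OF fin, of "\<lambda>x. f - x"]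
    by linarith
  finally show ?thesis by (simp add: semigroup_genus_def)
qed

lemma finite_numerical_semigroups: "finite (numerical_semigroups g m)"
proof (rule finite_subset)
  show "numerical_semigroups g m \<subseteq> uminus ` Pow {..<2 * g}"
  proof
    fix S assume "S \<in> numerical_semigroups g m"
    then have "- S \<in> Pow {..<2 * g}"
      using gap_less_twice_genus by (auto simp: numerical_semigroups_def)
    moreover have "S = - (- S)" by simp
    ultimately show "S \<in> uminus ` Pow {..<2 * g}" by (rule rev_image_eqI)
  qed
qed simp

end

theory Submission
  imports Defs
begin

text \<open>
  A gapset of multiplicity 4 meets each residue class modulo 4 in an initial segment, so it is
  determined by the numbers \<open>a\<close>, \<open>b\<close>, \<open>c\<close> of its elements congruent to 1, 2, 3 (the Kunz
  coordinates of the complementary semigroup), and its genus is \<open>a + b + c\<close>. The triples that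
  occur are the triples of positive integers with
  \<open>b \<le> 2 * a\<close>, \<open>b \<le> 2 * c + 1\<close>, \<open>c \<le> a + b\<close> and \<open>a \<le> b + c + 1\<close>,
  each inequality saying that the sum of the least non-gaps in two residue classes is a non-gap
  (\<open>bij_betw_gaps_of\<close>).

  In these coordinates an injection from genus \<open>g\<close> to genus \<open>g + 1\<close> is elementary. Increasing
  \<open>a\<close> by one respects all the inequalities except possibly the last, so it is admissible unless
  \<open>a = b + c + 1\<close>. A triple with \<open>a = b + c + 1\<close> is sent to \<open>(c + 1, b, a)\<close> instead. This lies on
  the face where the third inequality is an equality, which the triples \<open>(a + 1, b, c)\<close> with
  \<open>c \<le> a + b\<close> never meet; so the two branches have disjoint images (\<open>inj_on_raise\<close>).

  Gapsets correspond to semigroups by complementation, and a gapset is recovered from its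
  filtration by translating the layers back (\<open>gapset_eq_shifted_layers\<close>). Hence the injection
  carries over to filtrations and to semigroups.
\<close>

section \<open>Gapsets, filtrations and semigroups\<close>

definition gapsets :: "nat \<Rightarrow> nat \<Rightarrow> nat set set" where
  "gapsets g m = {G. gapset G \<and> gapset_genus G = g \<and> gapset_multiplicity G = m}"

lemma gapset_multiplicity_nongap:
  assumes "finite G"
  shows "1 \<le> gapset_multiplicity G" "gapset_multiplicity G \<notin> G"
proof -
  obtain n where "n \<notin> insert 0 G"
    using ex_new_if_finite[OF infinite_UNIV_nat, of "insert 0 G"] assms by auto
  then have "1 \<le> n \<and> n \<notin> G" by auto
  then have "1 \<le> gapset_multiplicity G \<and> gapset_multiplicity G \<notin> G"
    unfolding gapset_multiplicity_def by (rule LeastI)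
  then show "1 \<le> gapset_multiplicity G" "gapset_multiplicity G \<notin> G" by auto
qed

lemma below_gapset_multiplicity:
  assumes "1 \<le> n" "n < gapset_multiplicity G"
  shows "n \<in> G"
  using assms not_less_Least unfolding gapset_multiplicity_def by blast

lemma gapset_finite: "gapset G \<Longrightarrow> finite G"
  and gapset_zero_notin: "gapset G \<Longrightarrow> 0 \<notin> G"
  unfolding gapset_def by blast+

lemma gapset_split:
  assumes "gapset G" "x + y \<in> G"
  shows "x \<in> G \<or> y \<in> G"
proof (cases "x = 0 \<or> y = 0")
  case True
  then show ?thesis using assms by auto
next
  case False
  then have "1 \<le> x" "1 \<le> y" by auto
  then show ?thesis using assms unfolding gapset_def by blast
qed

lemma gapset_mult_nongap:
  assumes "gapset G"
  shows "k * gapset_multiplicity G \<notin> G"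
proof (induction k)
  case 0
  then show ?case using gapset_zero_notin[OF assms] by simp
next
  case (Suc k)
  have "gapset_multiplicity G \<notin> G"
    using assms gapset_multiplicity_nongap(2) gapset_finite by blast
  then show ?case using Suc gapset_split[OF assms] by auto
qed

lemma gapset_conductor_le:
  assumes "gapset G"
  shows "gapset_conductor G \<le> gapset_depth G * gapset_multiplicity G"
proof -
  define m where "m = gapset_multiplicity G"
  have m: "0 < m"
    using gapset_multiplicity_nongap(1)[OF gapset_finite[OF assms]] by (simp add: m_def)
  have "real (gapset_conductor G) / real m \<le> real (gapset_depth G)"
    by (simp add: gapset_depth_def m_def)
  then have "real (gapset_conductor G) \<le> real (gapset_depth G * m)"
    using m by (simp add: field_simps)
  then show ?thesis unfolding m_def of_nat_le_iff .
qed

text \<open>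
  No gap is lost in passing to the filtration: a gap is never a multiple of \<open>m\<close>, and it lies
  below the conductor, hence in a block whose index is
  less than the depth.
\<close>

lemma gapset_eq_shifted_layers:
  assumes G: "gapset G" and m: "gapset_multiplicity G = m"
  shows "G = (\<Union>i<length (gapset_filtration G). (\<lambda>x. x + i * m) ` (gapset_filtration G ! i))"
proof -
  have nth: "(\<lambda>x. x + i * m) ` (gapset_filtration G ! i) = gapset_layer G i"
    if "i < gapset_depth G" for i
  proof -
    have "gapset_filtration G ! i = (\<lambda>x. x - i * m) ` gapset_layer G i"
      using that by (simp add: gapset_filtration_def m)
    then have "(\<lambda>x. x + i * m) ` (gapset_filtration G ! i)
        = (\<lambda>x. x - i * m + i * m) ` gapset_layer G i"
      by (simp add: image_image)
    also have "\<dots> = (\<lambda>x. x) ` gapset_layer G i"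
      by (rule image_cong) (auto simp: gapset_layer_def Let_def m)
    finally show ?thesis by simp
  qed
  have "x \<in> gapset_layer G (x div m) \<and> x div m < gapset_depth G" if x: "x \<in> G" for x
  proof -
    have m_pos: "0 < m"
      using gapset_multiplicity_nongap(1)[OF gapset_finite[OF G]] m by simp
    have x_eq: "x = x div m * m + x mod m" by simp
    have "x div m * m \<notin> G" using gapset_mult_nongap[OF G] m by simp
    then have "x mod m \<noteq> 0" using x x_eq by (metis add.right_neutral)
    then have r: "0 < x mod m" by simp
    have r': "x mod m < m" using m_pos by simp
    have "x < gapset_conductor G"
      using gapset_finite[OF G] x by (auto simp: gapset_conductor_def less_Suc_eq_le)
    also have "\<dots> \<le> gapset_depth G * m" using gapset_conductor_le[OF G] m by simp
    finally have "x div m < gapset_depth G" by (simp add: less_mult_imp_div_less)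
    moreover have "x div m * m + 1 \<le> x" "x \<le> (x div m + 1) * m - 1"
      using r r' x_eq unfolding distrib_right by linarith+
    ultimately show ?thesis using x by (simp add: gapset_layer_def Let_def m)
  qed
  then have "G = (\<Union>i<gapset_depth G. gapset_layer G i)"
    unfolding gapset_layer_def Let_def by blast
  also have "\<dots> = (\<Union>i<gapset_depth G. (\<lambda>x. x + i * m) ` (gapset_filtration G ! i))"
    using nth by simp
  finally show ?thesis by (simp add: gapset_filtration_def)
qed

lemma bij_betw_gapset_filtration:
  "bij_betw gapset_filtration (gapsets g m) (gapset_filtrations g m)"
proof -
  have "inj_on gapset_filtration (gapsets g m)"
  proof (rule inj_onI)
    fix G H
    assume "G \<in> gapsets g m" "H \<in> gapsets g m" and eq: "gapset_filtration G = gapset_filtration H"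
    then have "gapset G" "gapset_multiplicity G = m" "gapset H" "gapset_multiplicity H = m"
      by (auto simp: gapsets_def)
    note rec = gapset_eq_shifted_layers[OF this(1,2)] gapset_eq_shifted_layers[OF this(3,4)]
    show "G = H" by (subst rec(1), subst rec(2)) (simp only: eq)
  qed
  moreover have "gapset_filtration ` gapsets g m = gapset_filtrations g m"
    by (auto simp: gapset_filtrations_def gapsets_def)
  ultimately show ?thesis by (simp add: bij_betw_def)
qed

lemma numerical_semigroup_uminus_iff: "numerical_semigroup (- G) \<longleftrightarrow> gapset G"
proof
  assume "numerical_semigroup (- G)"
  then show "gapset G" by (auto simp: numerical_semigroup_def gapset_def)
next
  assume G: "gapset G"
  show "numerical_semigroup (- G)"
    using gapset_split[OF G] gapset_finite[OF G] gapset_zero_notin[OF G]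
    by (auto simp: numerical_semigroup_def)
qed

lemma bij_betw_uminus_gapsets: "bij_betw uminus (gapsets g m) (numerical_semigroups g m)"
proof -
  have "semigroup_multiplicity (- G) = gapset_multiplicity G" for G
    unfolding semigroup_multiplicity_def gapset_multiplicity_def
    by (rule arg_cong[where f = Least]) auto
  then have iff: "- G \<in> numerical_semigroups g m \<longleftrightarrow> G \<in> gapsets g m" for G
    by (simp add: numerical_semigroups_def gapsets_def numerical_semigroup_uminus_iff
        semigroup_genus_def gapset_genus_def)
  have "uminus ` gapsets g m = numerical_semigroups g m"
  proof (intro equalityI subsetI)
    fix S assume "S \<in> numerical_semigroups g m"
    then have "- S \<in> gapsets g m" using iff[of "- S"] by simp
    then show "S \<in> uminus ` gapsets g m" by (intro rev_image_eqI[of "- S"]) auto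
  qed (auto simp: iff)
  then show ?thesis by (auto simp: bij_betw_def inj_on_def)
qed

section \<open>Kunz coordinates in multiplicity 4\<close>

text \<open>
  The least non-gaps in the classes of 1, 2, 3 are \<open>4a + 1\<close>, \<open>4b + 2\<close>, \<open>4c + 3\<close>. The last four
  inequalities come, in this order, from the sums 1 + 1 = 2, 3 + 3 = 4 + 2, 1 + 2 = 3 and
  2 + 3 = 4 + 1 of residues; the carries account for the summands 1.
\<close>

definition kunz_triples :: "nat \<Rightarrow> (nat \<times> nat \<times> nat) set" where
  "kunz_triples g = {(a, b, c). 1 \<le> a \<and> 1 \<le> b \<and> 1 \<le> c \<and> a + b + c = g \<and>
     b \<le> 2 * a \<and> b \<le> 2 * c + 1 \<and> c \<le> a + b \<and> a \<le> b + c + 1}"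

definition gaps_of :: "nat \<times> nat \<times> nat \<Rightarrow> nat set" where
  "gaps_of = (\<lambda>(a, b, c).
     (\<lambda>i. 4 * i + 1) ` {..<a} \<union> (\<lambda>i. 4 * i + 2) ` {..<b} \<union> (\<lambda>i. 4 * i + 3) ` {..<c})"

lemma mem_gaps_of:
  "4 * i \<notin> gaps_of (a, b, c)"
  "4 * i + 1 \<in> gaps_of (a, b, c) \<longleftrightarrow> i < a"
  "4 * i + 2 \<in> gaps_of (a, b, c) \<longleftrightarrow> i < b"
  "4 * i + 3 \<in> gaps_of (a, b, c) \<longleftrightarrow> i < c"
  unfolding gaps_of_def by (auto; presburger)+

lemma nat_mod_4_cases:
  fixes n :: nat
  obtains i where "n = 4 * i" | i where "n = 4 * i + 1"
    | i where "n = 4 * i + 2" | i where "n = 4 * i + 3"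
proof -
  have "n = 4 * (n div 4) \<or> n = 4 * (n div 4) + 1 \<or> n = 4 * (n div 4) + 2 \<or> n = 4 * (n div 4) + 3"
    by presburger
  then show ?thesis using that by blast
qed

lemma finite_gaps_of: "finite (gaps_of t)"
  by (cases t) (simp add: gaps_of_def)

lemma card_gaps_of: "card (gaps_of (a, b, c)) = a + b + c"
proof -
  define A B C where "A = (\<lambda>i::nat. 4 * i + 1) ` {..<a}" and "B = (\<lambda>i::nat. 4 * i + 2) ` {..<b}"
    and "C = (\<lambda>i::nat. 4 * i + 3) ` {..<c}"
  have "card A = a" "card B = b" "card C = c"
    by (simp_all add: A_def B_def C_def card_image inj_on_def)
  moreover have "A \<inter> B = {}" "(A \<union> B) \<inter> C = {}"
    unfolding A_def B_def C_def by (auto; presburger)+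
  moreover have "finite A" "finite B" "finite C" by (simp_all add: A_def B_def C_def)
  moreover have "gaps_of (a, b, c) = A \<union> B \<union> C" by (simp add: gaps_of_def A_def B_def C_def)
  ultimately show ?thesis by (simp add: card_Un_disjoint)
qed

lemma inj_gaps_of: "inj gaps_of"
proof (rule injI)
  fix s t :: "nat \<times> nat \<times> nat"
  obtain a b c where s: "s = (a, b, c)" by (rule prod_cases3)
  obtain a' b' c' where t: "t = (a', b', c')" by (rule prod_cases3)
  assume "gaps_of s = gaps_of t"
  then have "\<forall>i. i < a \<longleftrightarrow> i < a'" "\<forall>i. i < b \<longleftrightarrow> i < b'" "\<forall>i. i < c \<longleftrightarrow> i < c'"
    using mem_gaps_of unfolding s t by metis+
  then show "s = t" unfolding s t by (metis linorder_neq_iff less_irrefl)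
qed

lemma gapset_gaps_of:
  assumes "(a, b, c) \<in> kunz_triples g"
  shows "gapset (gaps_of (a, b, c))"
proof -
  let ?G = "gaps_of (a, b, c)"
  have ineqs: "b \<le> 2 * a" "b \<le> 2 * c + 1" "c \<le> a + b" "a \<le> b + c + 1"
    using assms by (auto simp: kunz_triples_def)
  have add_residues:
    "4 * i + 4 * j = 4 * (i + j)"
    "4 * i + (4 * j + 1) = 4 * (i + j) + 1"
    "4 * i + (4 * j + 2) = 4 * (i + j) + 2"
    "4 * i + (4 * j + 3) = 4 * (i + j) + 3"
    "(4 * i + 1) + 4 * j = 4 * (i + j) + 1"
    "(4 * i + 1) + (4 * j + 1) = 4 * (i + j) + 2"
    "(4 * i + 1) + (4 * j + 2) = 4 * (i + j) + 3"
    "(4 * i + 1) + (4 * j + 3) = 4 * (i + j + 1)"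
    "(4 * i + 2) + 4 * j = 4 * (i + j) + 2"
    "(4 * i + 2) + (4 * j + 1) = 4 * (i + j) + 3"
    "(4 * i + 2) + (4 * j + 2) = 4 * (i + j + 1)"
    "(4 * i + 2) + (4 * j + 3) = 4 * (i + j + 1) + 1"
    "(4 * i + 3) + 4 * j = 4 * (i + j) + 3"
    "(4 * i + 3) + (4 * j + 1) = 4 * (i + j + 1)"
    "(4 * i + 3) + (4 * j + 2) = 4 * (i + j + 1) + 1"
    "(4 * i + 3) + (4 * j + 3) = 4 * (i + j + 1) + 2" for i j :: nat
    by simp_all
  have "x + y \<notin> ?G" if "x \<notin> ?G" "y \<notin> ?G" for x y
    by (rule nat_mod_4_cases[of x]; rule nat_mod_4_cases[of y];
        use that ineqs in \<open>simp only: add_residues mem_gaps_of simp_thms\<close>; linarith?)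
  moreover have "0 \<notin> ?G" using mem_gaps_of(1)[of 0] by simp
  ultimately show ?thesis unfolding gapset_def using finite_gaps_of by blast
qed

lemma gapset_multiplicity_eq_4_iff:
  assumes "finite G"
  shows "gapset_multiplicity G = 4 \<longleftrightarrow> 1 \<in> G \<and> 2 \<in> G \<and> 3 \<in> G \<and> 4 \<notin> G"
proof
  assume m: "gapset_multiplicity G = 4"
  then show "1 \<in> G \<and> 2 \<in> G \<and> 3 \<in> G \<and> 4 \<notin> G"
    using below_gapset_multiplicity[of _ G] gapset_multiplicity_nongap(2)[OF assms] by simp
next
  assume G: "1 \<in> G \<and> 2 \<in> G \<and> 3 \<in> G \<and> 4 \<notin> G"
  have "4 \<le> n" if "1 \<le> n \<and> n \<notin> G" for n
  proof (rule ccontr)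
    assume "\<not> 4 \<le> n"
    then have "n = 1 \<or> n = 2 \<or> n = 3" using that by linarith
    then show False using that G by auto
  qed
  then show "gapset_multiplicity G = 4"
    unfolding gapset_multiplicity_def using G by (intro Least_equality) auto
qed

lemma finite_downward_closed_nat:
  fixes P :: "nat \<Rightarrow> bool"
  assumes "finite {i. P i}" and step: "\<And>i. P (Suc i) \<Longrightarrow> P i"
  obtains a where "\<And>i. P i \<longleftrightarrow> i < a"
proof -
  define a where "a = (LEAST i. \<not> P i)"
  obtain n where "\<not> P n"
    using ex_new_if_finite[OF infinite_UNIV_nat assms(1)] by auto
  then have "\<not> P a" unfolding a_def by (rule LeastI)
  have "\<not> P i" if "a \<le> i" for i
    using that by (induction rule: dec_induct) (use \<open>\<not> P a\<close> step in auto)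
  moreover have "P i" if "i < a" for i
    using not_less_Least[of i "\<lambda>i. \<not> P i"] that by (auto simp: a_def)
  ultimately show ?thesis using that[of a] by (meson not_le)
qed

text \<open>
  As 4 is not a gap, each residue class of the gaps is closed under subtracting 4, hence an
  initial segment. Violating one of the inequalities would make the sum of the least
  non-gaps in two classes a gap.
\<close>

lemma gapset_4_eq_gaps_of:
  assumes G: "gapset G" and m: "gapset_multiplicity G = 4"
  obtains t where "t \<in> kunz_triples (card G)" "G = gaps_of t"
proof -
  have fin: "finite G" using G by (rule gapset_finite)
  have small: "1 \<in> G" "2 \<in> G" "3 \<in> G" "4 \<notin> G"
    using gapset_multiplicity_eq_4_iff[OF fin] m by auto
  have initial: "\<exists>k. \<forall>i. 4 * i + r \<in> G \<longleftrightarrow> i < k" for r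
  proof -
    have "inj (\<lambda>i. 4 * i + r)" by (simp add: inj_on_def)
    then have "finite ((\<lambda>i. 4 * i + r) -` G)" using fin by (rule finite_vimageI[rotated])
    then have "finite {i. 4 * i + r \<in> G}" by (simp add: vimage_def)
    moreover have "4 * i + r \<in> G" if "4 * Suc i + r \<in> G" for i
      using gapset_split[OF G, of 4 "4 * i + r"] that small by (simp add: algebra_simps)
    ultimately show ?thesis using finite_downward_closed_nat by metis
  qed
  obtain a where a: "\<And>i. 4 * i + 1 \<in> G \<longleftrightarrow> i < a" using initial[of 1] by blast
  obtain b where b: "\<And>i. 4 * i + 2 \<in> G \<longleftrightarrow> i < b" using initial[of 2] by blast
  obtain c where c: "\<And>i. 4 * i + 3 \<in> G \<longleftrightarrow> i < c" using initial[of 3] by blast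
  have zero: "4 * i \<notin> G" for i
    using gapset_mult_nongap[OF G, of i] m by (simp add: mult.commute)
  have eq: "G = gaps_of (a, b, c)"
  proof (rule set_eqI)
    fix n
    show "n \<in> G \<longleftrightarrow> n \<in> gaps_of (a, b, c)"
      by (rule nat_mod_4_cases[of n]) (simp_all only: a b c zero mem_gaps_of)
  qed
  have pos: "1 \<le> a" "1 \<le> b" "1 \<le> c" using a[of 0] b[of 0] c[of 0] small
    by (simp_all add: numeral_2_eq_2)
  have nongaps: "4 * a + 1 \<notin> G" "4 * b + 2 \<notin> G" "4 * c + 3 \<notin> G"
    by (simp_all only: a b c less_irrefl not_False_eq_True)
  have add: "x + y \<notin> G" if "x \<notin> G" "y \<notin> G" for x y
    using gapset_split[OF G] that by blast
  have "4 * (2 * a) + 2 \<notin> G"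
    using add[OF nongaps(1) nongaps(1)] by (simp add: algebra_simps)
  then have ba: "b \<le> 2 * a" unfolding b by simp
  have "4 * (2 * c + 1) + 2 \<notin> G"
    using add[OF nongaps(3) nongaps(3)] by (simp add: algebra_simps)
  then have bc: "b \<le> 2 * c + 1" unfolding b by simp
  have "4 * (a + b) + 3 \<notin> G"
    using add[OF nongaps(1) nongaps(2)] by (simp add: algebra_simps numeral_3_eq_3)
  then have cab: "c \<le> a + b" unfolding c by simp
  have "4 * (b + c + 1) + 1 \<notin> G"
    using add[OF nongaps(2) nongaps(3)] by (simp add: algebra_simps)
  then have abc: "a \<le> b + c + 1" unfolding a by simp
  have "a + b + c = card G" by (simp add: eq card_gaps_of)
  then show ?thesis using pos ba bc cab abc that[of "(a, b, c)"] eq by (simp add: kunz_triples_def)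
qed

lemma bij_betw_gaps_of: "bij_betw gaps_of (kunz_triples g) (gapsets g 4)"
proof -
  have "gaps_of t \<in> gapsets g 4" if t: "t \<in> kunz_triples g" for t
  proof -
    obtain a b c where abc: "t = (a, b, c)" by (rule prod_cases3)
    have "0 < a" "0 < b" "0 < c" "a + b + c = g" using t by (auto simp: abc kunz_triples_def)
    then have "gapset_multiplicity (gaps_of t) = 4"
      using mem_gaps_of(2-4)[of 0 a b c] mem_gaps_of(1)[of 1 a b c]
      by (simp add: gapset_multiplicity_eq_4_iff finite_gaps_of abc numeral_2_eq_2)
    then show ?thesis
      using gapset_gaps_of t \<open>a + b + c = g\<close>
      by (simp add: gapsets_def gapset_genus_def abc card_gaps_of)
  qed
  moreover have "G \<in> gaps_of ` kunz_triples g" if "G \<in> gapsets g 4" for G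
    using that gapset_4_eq_gaps_of[of G] by (auto simp: gapsets_def gapset_genus_def)
  ultimately show ?thesis
    using inj_gaps_of by (auto simp: bij_betw_def intro: inj_on_subset)
qed

section \<open>The injection\<close>

fun raise :: "nat \<times> nat \<times> nat \<Rightarrow> nat \<times> nat \<times> nat" where
  "raise (a, b, c) = (if a \<le> b + c then (a + 1, b, c) else (c + 1, b, a))"

lemma raise_kunz_triples: "t \<in> kunz_triples g \<Longrightarrow> raise t \<in> kunz_triples (g + 1)"
  by (cases t) (auto simp: kunz_triples_def)

text \<open>
  The branch can be read off from the image \<open>(a', b', c')\<close>: in the first branch
  \<open>c' < a' + b'\<close>, in the second \<open>c' = a' + b'\<close>.
\<close>

lemma inj_on_raise: "inj_on raise (kunz_triples g)"
proof (rule inj_onI)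
  fix s t assume st: "s \<in> kunz_triples g" "t \<in> kunz_triples g" "raise s = raise t"
  obtain a b c where s: "s = (a, b, c)" by (rule prod_cases3)
  obtain a' b' c' where t: "t = (a', b', c')" by (rule prod_cases3)
  have "c \<le> a + b" "a \<le> b + c + 1" "c' \<le> a' + b'" "a' \<le> b' + c' + 1"
    using st(1,2) by (simp_all add: kunz_triples_def s t)
  moreover have "(if a \<le> b + c then (a + 1, b, c) else (c + 1, b, a))
      = (if a' \<le> b' + c' then (a' + 1, b', c') else (c' + 1, b', a'))"
    using st(3) unfolding s t raise.simps .
  ultimately have "a = a' \<and> b = b' \<and> c = c'"
    by (cases "a \<le> b + c"; cases "a' \<le> b' + c'"; simp only: if_True if_False prod.inject; linarith)
  then show "s = t" by (simp add: s t)
qed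

text \<open>
  Filtrations and semigroups are both in bijection with gapsets, so they are both coordinatised
  by Kunz triples; conjugating \<^const>\<open>raise\<close> by these coordinates serves both.
\<close>

lemma inj_raise_transfer:
  assumes bij: "\<And>n. bij_betw h (gapsets n 4) (X n)"
  obtains f where "inj_on f (X g)" "f ` X g \<subseteq> X (g + 1)"
proof -
  define coord where "coord = inv_into (kunz_triples g) (h \<circ> gaps_of)"
  have triples: "bij_betw (h \<circ> gaps_of) (kunz_triples n) (X n)" for n
    using bij_betw_trans[OF bij_betw_gaps_of bij] .
  have coord: "inj_on coord (X g)" "coord ` X g = kunz_triples g"
    using bij_betw_inv_into[OF triples] by (simp_all add: bij_betw_def coord_def)
  have sub: "(raise \<circ> coord) ` X g \<subseteq> kunz_triples (g + 1)"
  proof (rule image_subsetI)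
    fix x assume "x \<in> X g"
    then have "coord x \<in> kunz_triples g" using coord(2) by blast
    then show "(raise \<circ> coord) x \<in> kunz_triples (g + 1)"
      unfolding o_apply by (rule raise_kunz_triples)
  qed
  have "inj_on (raise \<circ> coord) (X g)"
    using coord inj_on_raise by (simp add: comp_inj_on)
  moreover have "inj_on (h \<circ> gaps_of) ((raise \<circ> coord) ` X g)"
    using triples[of "g + 1"] sub unfolding bij_betw_def by (blast intro: inj_on_subset)
  ultimately have "inj_on ((h \<circ> gaps_of) \<circ> (raise \<circ> coord)) (X g)"
    by (rule comp_inj_on)
  moreover have "((h \<circ> gaps_of) \<circ> (raise \<circ> coord)) ` X g \<subseteq> X (g + 1)"
    using sub triples[of "g + 1"] unfolding bij_betw_def image_comp[symmetric] by blast
  ultimately show ?thesis by (rule that)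
qed

theorem corollary5p2:
  fixes g :: nat
  shows "(\<exists>f. inj_on f (gapset_filtrations g 4) \<and>
              f ` gapset_filtrations g 4 \<subseteq> gapset_filtrations (g + 1) 4) \<and>
         num_semigroups (g + 1) 4 \<ge> num_semigroups g 4"
proof
  show "\<exists>f. inj_on f (gapset_filtrations g 4) \<and>
            f ` gapset_filtrations g 4 \<subseteq> gapset_filtrations (g + 1) 4"
    by (rule inj_raise_transfer[of gapset_filtration "\<lambda>n. gapset_filtrations n 4" g])
      (auto intro: bij_betw_gapset_filtration)
  obtain f where "inj_on f (numerical_semigroups g 4)"
    "f ` numerical_semigroups g 4 \<subseteq> numerical_semigroups (g + 1) 4"
    using inj_raise_transfer[of uminus "\<lambda>n. numerical_semigroups n 4" g] bij_betw_uminus_gapsets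
    by metis
  then show "num_semigroups g 4 \<le> num_semigroups (g + 1) 4"
    unfolding num_semigroups_def using finite_numerical_semigroups by (rule card_inj_on_le)
qed

end
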